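(* Let $H$ be a graph with maximum degree $|V(H)|-1$. Suppose the number of vertices with degree $|V(H)|-1$ in $H$ is $k$. Then $$fix_f(K_1\odot H)=\begin{cases} fix_f(H)+1, & \text{if } k=1,\\ fix_f(H)+\frac12, & \text{if } k\ge 2.\end{cases}$$
   Context: All graphs are finite, simple, undirected and non-trivial (at least two vertices), except for the one-vertex graph $K_1$ explicitly mentioned. $K_1\odot H$ (the corona product of $K_1$ with $H$) is the graph obtained from $H$ by adding one new vertex adjacent to all vertices of $H$. Let $\Gamma=\Gamma(G)$ be the automorphism group of a graph $G$. For $u\in V(G)$, $O(u)$ is the $\Gamma$-orbit of $u$; for $x\in V(G)$, $\Gamma_x$ is the stabilizer of $x$ and $O_x(u)=\{\pi(u):\pi\in\Gamma_x\}$. Let $V_a(G)=\{(u,v): u\neq v,\ O(u)=O(v)\}$. For vertices $u,v$ let $F(u,v)=\{x\in V(G):O_x(u)\neq O_x(v)\}$. A function $g:V(G)\to[0,1]$ is a fixing function of $G$ if $\sum_{x\in F(u,v)}g(x)\ge 1$ for every $(u,v)\in V_a(G)$. Put $|g|=\sum_{x\in V(G)}g(x)$. The fractional fixing number $fix_f(G)$ is the minimum of $|g|$ over all fixing functions $g$ of $G$ (so it is $0$ if $G$ has trivial automorphism group). *)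

theory Defs
  imports "HOL-Analysis.Analysis" "HOL-Combinatorics.Permutations"
begin

text \<open>A graph is a pair of a vertex set and a set of edges, the edges being two-element sets
  of vertices.\<close>

type_synonym 'a graph = "'a set \<times> 'a set set"

abbreviation verts :: "'a graph \<Rightarrow> 'a set" where
  "verts G \<equiv> fst G"

abbreviation edges :: "'a graph \<Rightarrow> 'a set set" where
  "edges G \<equiv> snd G"

definition simple_graph :: "'a graph \<Rightarrow> bool" where
  "simple_graph G \<longleftrightarrow> finite (verts G) \<and>
     (\<forall>e \<in> edges G. \<exists>u \<in> verts G. \<exists>v \<in> verts G. u \<noteq> v \<and> e = {u, v})"

definition vertex_degree :: "'a graph \<Rightarrow> 'a \<Rightarrow> nat" where
  "vertex_degree G u = card {v \<in> verts G. {u, v} \<in> edges G}"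

definition max_degree :: "'a graph \<Rightarrow> nat" where
  "max_degree G = Max (vertex_degree G ` verts G)"

text \<open>The corona product of the one-vertex graph with \<open>H\<close>. The new vertex is \<open>None\<close>; a vertex
  \<open>u\<close> of \<open>H\<close> becomes \<open>Some u\<close>.\<close>

definition K1_corona :: "'a graph \<Rightarrow> 'a option graph" where
  "K1_corona H =
     (insert None (Some ` verts H),
      (\<lambda>e. Some ` e) ` edges H \<union> {{None, Some u} | u. u \<in> verts H})"

text \<open>Since \<open>permutes\<close> makes a permutation the identity outside the vertex set, distinct
  elements of \<open>automorphisms G\<close> are distinct automorphisms of the graph.\<close>

definition automorphisms :: "'a graph \<Rightarrow> ('a \<Rightarrow> 'a) set" where
  "automorphisms G = {\<pi>. \<pi> permutes verts G \<and>
     (\<forall>u \<in> verts G. \<forall>v \<in> verts G. {\<pi> u, \<pi> v} \<in> edges G \<longleftrightarrow> {u, v} \<in> edges G)}"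

definition stabilizer :: "'a graph \<Rightarrow> 'a \<Rightarrow> ('a \<Rightarrow> 'a) set" where
  "stabilizer G x = {\<pi> \<in> automorphisms G. \<pi> x = x}"

definition orbit :: "'a graph \<Rightarrow> 'a \<Rightarrow> 'a set" where
  "orbit G u = {\<pi> u | \<pi>. \<pi> \<in> automorphisms G}"

definition stab_orbit :: "'a graph \<Rightarrow> 'a \<Rightarrow> 'a \<Rightarrow> 'a set" where
  "stab_orbit G x u = {\<pi> u | \<pi>. \<pi> \<in> stabilizer G x}"

definition Va :: "'a graph \<Rightarrow> ('a \<times> 'a) set" where
  "Va G = {(u, v). u \<in> verts G \<and> v \<in> verts G \<and> u \<noteq> v \<and> orbit G u = orbit G v}"

definition fixing_set :: "'a graph \<Rightarrow> 'a \<Rightarrow> 'a \<Rightarrow> 'a set" where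
  "fixing_set G u v = {x \<in> verts G. stab_orbit G x u \<noteq> stab_orbit G x v}"

definition fixing_function :: "'a graph \<Rightarrow> ('a \<Rightarrow> real) \<Rightarrow> bool" where
  "fixing_function G g \<longleftrightarrow> (\<forall>x \<in> verts G. g x \<in> {0..1}) \<and>
     (\<forall>(u, v) \<in> Va G. (\<Sum>x \<in> fixing_set G u v. g x) \<ge> 1)"

definition weight :: "'a graph \<Rightarrow> ('a \<Rightarrow> real) \<Rightarrow> real" where
  "weight G g = (\<Sum>x \<in> verts G. g x)"

text \<open>The minimum is attained on every simple graph: see \<open>fix_f_attained\<close> and \<open>fix_f_le\<close> below.\<close>

definition fix_f :: "'a graph \<Rightarrow> real" where
  "fix_f G = (LEAST r. \<exists>g. fixing_function G g \<and> r = weight G g)"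

lemma fixing_function_const_1:
  assumes "simple_graph G"
  shows "fixing_function G (\<lambda>_. 1)"
proof -
  have "(\<Sum>x \<in> fixing_set G u v. 1::real) \<ge> 1" if "(u, v) \<in> Va G" for u v
  proof -
    have uv: "u \<in> verts G" "v \<in> verts G" "u \<noteq> v"
      using that by (auto simp: Va_def)
    have "id \<in> stabilizer G u"
      by (simp add: stabilizer_def automorphisms_def permutes_id)
    then have "v \<in> stab_orbit G u v"
      unfolding stab_orbit_def by (intro CollectI exI[of _ id]) simp
    moreover have "v \<notin> stab_orbit G u u"
      using uv by (auto simp: stab_orbit_def stabilizer_def)
    ultimately have "u \<in> fixing_set G u v"
      using uv by (auto simp: fixing_set_def)
    moreover have "finite (fixing_set G u v)"
      using assms by (simp add: fixing_set_def simple_graph_def)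
    ultimately have "card (fixing_set G u v) \<ge> 1"
      using card_gt_0_iff[of "fixing_set G u v"] by auto
    then show ?thesis by simp
  qed
  then show ?thesis by (auto simp: fixing_function_def)
qed

lemma minimal_fixing_function_exists:
  assumes "simple_graph G"
  shows "\<exists>g. fixing_function G g \<and> (\<forall>h. fixing_function G h \<longrightarrow> weight G g \<le> weight G h)"
proof -
  define K :: "('a \<Rightarrow> real) set"
    where "K = PiE UNIV (\<lambda>x. if x \<in> verts G then {0..1} else {0})"
  define C where "C = (\<Inter>(u, v) \<in> Va G. {g. (\<Sum>x \<in> fixing_set G u v. g x) \<ge> (1::real)})"
  define trunc where "trunc h = (\<lambda>x. if x \<in> verts G then h x else (0::real))" for h
  have "compactin (product_topology (\<lambda>_::'a. euclidean::real topology) UNIV) K"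
    unfolding K_def by (subst compactin_PiE) auto
  then have "compact K"
    by (simp add: euclidean_product_topology)
  moreover have "closed C"
    unfolding C_def case_prod_beta
    by (intro closed_INT ballI closed_Collect_le continuous_on_sum continuous_on_const) auto
  ultimately have comp: "compact (K \<inter> C)" by (rule compact_Int_closed)
  have trunc: "trunc h \<in> K \<inter> C" "weight G (trunc h) = weight G h"
    if "fixing_function G h" for h
  proof -
    have "(\<Sum>x \<in> fixing_set G u v. trunc h x) = (\<Sum>x \<in> fixing_set G u v. h x)" for u v
      by (rule sum.cong) (auto simp: trunc_def fixing_set_def)
    then show "trunc h \<in> K \<inter> C"
      using that by (auto simp: K_def C_def fixing_function_def trunc_def)
    show "weight G (trunc h) = weight G h"
      by (simp add: weight_def trunc_def)
  qed
  have "continuous_on (K \<inter> C) (weight G)"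
    unfolding weight_def
    by (intro continuous_on_sum continuous_on_subset[OF continuous_on_product_coordinates]) auto
  moreover have "K \<inter> C \<noteq> {}"
    using trunc(1)[OF fixing_function_const_1[OF assms]] by auto
  ultimately obtain g where g: "g \<in> K \<inter> C" "\<And>h. h \<in> K \<inter> C \<Longrightarrow> weight G g \<le> weight G h"
    using continuous_attains_inf[OF comp] by blast
  have "g x \<in> {0..1}" if "x \<in> verts G" for x
    using g(1) that by (auto simp: K_def PiE_iff split: if_splits)
  then have "fixing_function G g"
    using g(1) by (auto simp: C_def fixing_function_def)
  moreover have "weight G g \<le> weight G h" if "fixing_function G h" for h
    using g(2)[OF trunc(1)[OF that]] trunc(2)[OF that] by simp
  ultimately show ?thesis by blast
qed

lemma fix_f_eq_weight:
  assumes "fixing_function G g"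
    and "\<And>h. fixing_function G h \<Longrightarrow> weight G g \<le> weight G h"
  shows "fix_f G = weight G g"
  unfolding fix_f_def using assms by (intro Least_equality) auto

lemma fix_f_attained:
  assumes "simple_graph G"
  shows "\<exists>g. fixing_function G g \<and> weight G g = fix_f G"
  using minimal_fixing_function_exists[OF assms] fix_f_eq_weight by metis

lemma fix_f_le:
  assumes "simple_graph G" "fixing_function G h"
  shows "fix_f G \<le> weight G h"
  using minimal_fixing_function_exists[OF assms(1)] fix_f_eq_weight assms(2) by metis

end

theory Submission
  imports Defs
begin

text \<open>Call a vertex universal if it is adjacent to every other vertex, and let \<open>U\<close> be the set of
  universal vertices of a graph \<open>G\<close>. An automorphism preserves \<open>U\<close>, and it can act on \<open>U\<close> and on
  the graph \<open>G - U\<close> independently: the automorphism group of \<open>G\<close> is the direct product of the full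
  symmetric group on \<open>U\<close> and the automorphism group of \<open>G - U\<close>. So the linear program
  that defines \<open>fix_f G\<close> splits into two independent programs (\<open>fixing_function_iff_split\<close>):

  \<^item> on the vertices outside \<open>U\<close> it is the program of \<open>G - U\<close>, because the stabilizer of a universal
    vertex still induces all automorphisms of \<open>G - U\<close>, so that a universal vertex
    never separates two vertices of one orbit there;

  \<^item> on \<open>U\<close> the constraints are \<open>g u + g v \<ge> 1\<close> for all \<open>u \<noteq> v\<close>, because the transposition of
    \<open>u\<close> and \<open>v\<close> is an automorphism that fixes every other vertex.

  The second program has the optimum \<open>card U / 2\<close> if \<open>U\<close> has at least two elements
  (\<open>half_card_le_sum_if_pairs_ge_1\<close>), and the optimum \<open>0\<close> otherwise, since it has no constraints
  then. This gives \<open>fix_f_remove_universal\<close>.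

  The corona product with the one-vertex graph adds one universal vertex to \<open>H\<close> and, up to the
  renaming \<open>Some\<close>, leaves the graph on the non-universal vertices as it was. Hence the passage
  from \<open>H\<close> to the corona changes \<open>fix_f\<close> exactly by the change of the second optimum when the
  number of universal vertices grows from \<open>k\<close> to \<open>k + 1\<close>: from \<open>0\<close> to \<open>1\<close> if \<open>k = 1\<close>, and from
  \<open>k / 2\<close> to \<open>(k + 1) / 2\<close> if \<open>k \<ge> 2\<close>.\<close>


section \<open>Invariance of the fractional fixing number under isomorphism\<close>

definition graph_iso :: "('a \<Rightarrow> 'b) \<Rightarrow> 'a graph \<Rightarrow> 'b graph \<Rightarrow> bool" where
  "graph_iso h G G' \<longleftrightarrow> bij_betw h (verts G) (verts G') \<and>
     (\<forall>u \<in> verts G. \<forall>v \<in> verts G. {h u, h v} \<in> edges G' \<longleftrightarrow> {u, v} \<in> edges G)"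

lemma automorphismsD:
  assumes "\<pi> \<in> automorphisms G"
  shows "\<pi> permutes verts G"
    and "u \<in> verts G \<Longrightarrow> v \<in> verts G \<Longrightarrow> {\<pi> u, \<pi> v} \<in> edges G \<longleftrightarrow> {u, v} \<in> edges G"
  using assms by (simp_all add: automorphisms_def)

lemma automorphism_in_verts:
  "\<pi> \<in> automorphisms G \<Longrightarrow> u \<in> verts G \<Longrightarrow> \<pi> u \<in> verts G"
  by (auto simp: automorphisms_def permutes_in_image)

lemma id_in_automorphisms: "id \<in> automorphisms G"
  by (simp add: automorphisms_def permutes_id)

lemma stab_orbit_subset: "u \<in> verts G \<Longrightarrow> stab_orbit G x u \<subseteq> verts G"
  by (auto simp: stab_orbit_def stabilizer_def automorphism_in_verts)

lemma orbit_subset: "u \<in> verts G \<Longrightarrow> orbit G u \<subseteq> verts G"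
  by (auto simp: orbit_def automorphism_in_verts)

lemma self_in_orbit: "u \<in> orbit G u"
  unfolding orbit_def using id_in_automorphisms[of G] by (intro CollectI exI[of _ id]) simp

lemma graph_iso_inverse:
  assumes "graph_iso h G G'"
  shows "graph_iso (inv_into (verts G) h) G' G"
proof -
  have b: "bij_betw h (verts G) (verts G')"
    using assms by (simp add: graph_iso_def)
  have "{inv_into (verts G) h a, inv_into (verts G) h b} \<in> edges G \<longleftrightarrow> {a, b} \<in> edges G'"
    if "a \<in> verts G'" "b \<in> verts G'" for a b
  proof -
    have "inv_into (verts G) h a \<in> verts G" "inv_into (verts G) h b \<in> verts G"
      using b that by (metis bij_betw_def inv_into_into)+
    moreover have "h (inv_into (verts G) h a) = a" "h (inv_into (verts G) h b) = b"
      using b that by (simp_all add: bij_betw_inv_into_right)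
    ultimately show ?thesis
      using assms unfolding graph_iso_def by metis
  qed
  then show ?thesis
    using bij_betw_inv_into[OF b] by (simp add: graph_iso_def)
qed

text \<open>Conjugation by an isomorphism carries automorphisms over.\<close>

lemma automorphism_transport:
  assumes iso: "graph_iso h G G'" and \<pi>: "\<pi> \<in> automorphisms G"
  obtains \<pi>' where "\<pi>' \<in> automorphisms G'" "\<And>u. u \<in> verts G \<Longrightarrow> \<pi>' (h u) = h (\<pi> u)"
proof
  let ?\<pi>' = "map_permutation (verts G) h \<pi>"
  have b: "bij_betw h (verts G) (verts G')" and inj: "inj_on h (verts G)"
    and img: "h ` verts G = verts G'"
    using iso by (auto simp: graph_iso_def bij_betw_def)
  have p: "\<pi> permutes verts G"
    using \<pi> by (simp add: automorphisms_def)
  show act: "?\<pi>' (h u) = h (\<pi> u)" if "u \<in> verts G" for u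
    using that inj by (simp add: map_permutation_apply)
  have "?\<pi>' permutes verts G'"
    using map_permutation_permutes[OF b p] .
  moreover have "{?\<pi>' (h u), ?\<pi>' (h v)} \<in> edges G' \<longleftrightarrow> {h u, h v} \<in> edges G'"
    if "u \<in> verts G" "v \<in> verts G" for u v
    using that iso \<pi> automorphism_in_verts[OF \<pi>]
    by (simp add: act graph_iso_def automorphisms_def)
  ultimately show "?\<pi>' \<in> automorphisms G'"
    unfolding automorphisms_def img[symmetric] by auto
qed

lemma orbit_iso_subset:
  assumes "graph_iso h G G'" "u \<in> verts G"
  shows "h ` orbit G u \<subseteq> orbit G' (h u)"
proof
  fix y assume "y \<in> h ` orbit G u"
  then obtain \<pi> where \<pi>: "\<pi> \<in> automorphisms G" "y = h (\<pi> u)"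
    by (auto simp: orbit_def)
  from automorphism_transport[OF assms(1) \<pi>(1)] obtain \<pi>'
    where "\<pi>' \<in> automorphisms G'" "\<pi>' (h u) = h (\<pi> u)"
    using assms(2) by metis
  then show "y \<in> orbit G' (h u)"
    using \<pi>(2) unfolding orbit_def by (intro CollectI exI[of _ \<pi>']) simp
qed

lemma stab_orbit_iso_subset:
  assumes "graph_iso h G G'" "u \<in> verts G" "x \<in> verts G"
  shows "h ` stab_orbit G x u \<subseteq> stab_orbit G' (h x) (h u)"
proof
  fix y assume "y \<in> h ` stab_orbit G x u"
  then obtain \<pi> where \<pi>: "\<pi> \<in> automorphisms G" "\<pi> x = x" "y = h (\<pi> u)"
    by (auto simp: stab_orbit_def stabilizer_def)
  from automorphism_transport[OF assms(1) \<pi>(1)] obtain \<pi>'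
    where "\<pi>' \<in> automorphisms G'" "\<pi>' (h u) = h (\<pi> u)" "\<pi>' (h x) = h x"
    using assms(2,3) \<pi>(2) by metis
  then show "y \<in> stab_orbit G' (h x) (h u)"
    using \<pi>(3) unfolding stab_orbit_def stabilizer_def by (intro CollectI exI[of _ \<pi>']) simp
qed

lemma image_inv_into_subset_imp_eq:
  assumes "bij_betw h V W" "A \<subseteq> V" "B \<subseteq> W" "h ` A \<subseteq> B" "inv_into V h ` B \<subseteq> A"
  shows "h ` A = B"
proof -
  have "B = h ` (inv_into V h ` B)"
    using assms(1,3) by (metis bij_betw_imp_surj_on image_inv_into_cancel)
  then show ?thesis
    using assms(4,5) by blast
qed

lemma orbit_iso:
  assumes iso: "graph_iso h G G'" and u: "u \<in> verts G"
  shows "orbit G' (h u) = h ` orbit G u"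
proof -
  have b: "bij_betw h (verts G) (verts G')"
    using iso by (simp add: graph_iso_def)
  have hu: "h u \<in> verts G'"
    using b u by (auto simp: bij_betw_def)
  have "inv_into (verts G) h ` orbit G' (h u) \<subseteq> orbit G u"
    using orbit_iso_subset[OF graph_iso_inverse[OF iso] hu] b u
    by (simp add: bij_betw_inv_into_left)
  then show ?thesis
    using image_inv_into_subset_imp_eq[OF b orbit_subset[OF u] orbit_subset[OF hu]
        orbit_iso_subset[OF iso u]] by simp
qed

lemma stab_orbit_iso:
  assumes iso: "graph_iso h G G'" and u: "u \<in> verts G" and x: "x \<in> verts G"
  shows "stab_orbit G' (h x) (h u) = h ` stab_orbit G x u"
proof -
  have b: "bij_betw h (verts G) (verts G')"
    using iso by (simp add: graph_iso_def)
  have hu: "h u \<in> verts G'" and hx: "h x \<in> verts G'"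
    using b u x by (auto simp: bij_betw_def)
  have "inv_into (verts G) h ` stab_orbit G' (h x) (h u) \<subseteq> stab_orbit G x u"
    using stab_orbit_iso_subset[OF graph_iso_inverse[OF iso] hu hx] b u x
    by (simp add: bij_betw_inv_into_left)
  then show ?thesis
    using image_inv_into_subset_imp_eq[OF b stab_orbit_subset[OF u] stab_orbit_subset[OF hu]
        stab_orbit_iso_subset[OF iso u x]] by simp
qed

lemma fixing_set_iso:
  assumes iso: "graph_iso h G G'" and u: "u \<in> verts G" and v: "v \<in> verts G"
  shows "fixing_set G' (h u) (h v) = h ` fixing_set G u v"
proof -
  have inj: "inj_on h (verts G)" and img: "verts G' = h ` verts G"
    using iso by (auto simp: graph_iso_def bij_betw_def)
  have "stab_orbit G' (h x) (h u) = stab_orbit G' (h x) (h v) \<longleftrightarrow>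
        stab_orbit G x u = stab_orbit G x v" if "x \<in> verts G" for x
    using that u v inj by (simp add: stab_orbit_iso[OF iso] inj_on_image_eq_iff stab_orbit_subset)
  then show ?thesis
    by (auto simp: fixing_set_def img)
qed

lemma Va_iso:
  assumes iso: "graph_iso h G G'" and uv: "(u, v) \<in> Va G"
  shows "(h u, h v) \<in> Va G'"
proof -
  have "bij_betw h (verts G) (verts G')"
    using iso by (simp add: graph_iso_def)
  then show ?thesis
    using uv orbit_iso[OF iso, of u] orbit_iso[OF iso, of v]
    by (auto simp: Va_def bij_betw_def inj_on_def)
qed

lemma fixing_function_pullback:
  assumes iso: "graph_iso h G G'" and g: "fixing_function G' g"
  shows "fixing_function G (g \<circ> h)" and "weight G (g \<circ> h) = weight G' g"
proof -
  have b: "bij_betw h (verts G) (verts G')"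
    using iso by (simp add: graph_iso_def)
  then show "weight G (g \<circ> h) = weight G' g"
    by (simp add: weight_def sum.reindex_bij_betw)
  have "(\<Sum>x \<in> fixing_set G u v. (g \<circ> h) x) \<ge> 1" if uv: "(u, v) \<in> Va G" for u v
  proof -
    have V: "u \<in> verts G" "v \<in> verts G"
      using uv by (auto simp: Va_def)
    have "inj_on h (fixing_set G u v)"
      using b by (auto simp: bij_betw_def fixing_set_def intro: inj_on_subset)
    then have "(\<Sum>x \<in> fixing_set G u v. (g \<circ> h) x) = (\<Sum>x \<in> fixing_set G' (h u) (h v). g x)"
      by (simp add: fixing_set_iso[OF iso V] sum.reindex)
    then show ?thesis
      using g Va_iso[OF iso uv] by (auto simp: fixing_function_def)
  qed
  then show "fixing_function G (g \<circ> h)"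
    using g b by (auto simp: fixing_function_def bij_betw_def)
qed

theorem fix_f_iso:
  assumes "graph_iso h G G'" "simple_graph G" "simple_graph G'"
  shows "fix_f G = fix_f G'"
proof (rule antisym)
  show "fix_f G \<le> fix_f G'"
    using fix_f_attained[OF assms(3)] fix_f_le[OF assms(2)] fixing_function_pullback[OF assms(1)]
    by metis
  show "fix_f G' \<le> fix_f G"
    using fix_f_attained[OF assms(2)] fix_f_le[OF assms(3)]
      fixing_function_pullback[OF graph_iso_inverse[OF assms(1)]]
    by metis
qed


section \<open>Automorphisms and universal vertices\<close>

definition universal :: "'a graph \<Rightarrow> 'a set" where
  "universal G = {v \<in> verts G. \<forall>u \<in> verts G. u \<noteq> v \<longrightarrow> {u, v} \<in> edges G}"

definition remove_universal :: "'a graph \<Rightarrow> 'a graph" where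
  "remove_universal G =
     (verts G - universal G, {e \<in> edges G. e \<subseteq> verts G - universal G})"

lemma verts_remove_universal [simp]: "verts (remove_universal G) = verts G - universal G"
  by (simp add: remove_universal_def)

lemma edge_remove_universal [simp]:
  "{u, v} \<in> edges (remove_universal G) \<longleftrightarrow>
   u \<in> verts G - universal G \<and> v \<in> verts G - universal G \<and> {u, v} \<in> edges G"
  by (auto simp: remove_universal_def)

lemma universal_subset: "universal G \<subseteq> verts G"
  by (auto simp: universal_def)

lemma finite_universal: "simple_graph G \<Longrightarrow> finite (universal G)"
  using universal_subset[of G] by (auto simp: simple_graph_def intro: finite_subset)

lemma simple_graph_remove_universal:
  assumes "simple_graph G"
  shows "simple_graph (remove_universal G)"
proof -
  have "\<exists>u \<in> verts G - universal G. \<exists>v \<in> verts G - universal G. u \<noteq> v \<and> e = {u, v}"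
    if "e \<in> edges (remove_universal G)" for e
    using that assms unfolding simple_graph_def remove_universal_def by fastforce
  then show ?thesis
    using assms by (simp add: simple_graph_def)
qed

lemma singleton_not_edge: "simple_graph G \<Longrightarrow> {u} \<notin> edges G"
  by (auto simp: simple_graph_def)

lemma automorphism_universal_iff:
  assumes \<pi>: "\<pi> \<in> automorphisms G" and v: "v \<in> verts G"
  shows "\<pi> v \<in> universal G \<longleftrightarrow> v \<in> universal G"
proof -
  have p: "\<pi> permutes verts G"
    and edge: "\<And>u w. u \<in> verts G \<Longrightarrow> w \<in> verts G \<Longrightarrow>
      {\<pi> u, \<pi> w} \<in> edges G \<longleftrightarrow> {u, w} \<in> edges G"
    using \<pi> by (auto simp: automorphisms_def)
  have "(\<forall>u \<in> verts G. u \<noteq> \<pi> v \<longrightarrow> {u, \<pi> v} \<in> edges G) \<longleftrightarrow>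
        (\<forall>u \<in> \<pi> ` verts G. u \<noteq> \<pi> v \<longrightarrow> {u, \<pi> v} \<in> edges G)"
    using permutes_image[OF p] by simp
  also have "\<dots> \<longleftrightarrow> (\<forall>u \<in> verts G. u \<noteq> v \<longrightarrow> {u, v} \<in> edges G)"
    using edge v permutes_inj[OF p] by (auto simp: inj_eq)
  finally show ?thesis
    using v automorphism_in_verts[OF \<pi>] by (simp add: universal_def)
qed

text \<open>Edges that meet a universal vertex impose no condition on a permutation that preserves the set
  of universal vertices: all such pairs of distinct vertices are edges. This is why the
  symmetric group on the universal vertices and the automorphism group of the rest can be
  combined freely.\<close>

lemma automorphismI_universal:
  assumes G: "simple_graph G" and p: "\<pi> permutes verts G"
    and univ: "\<And>v. v \<in> verts G \<Longrightarrow> \<pi> v \<in> universal G \<longleftrightarrow> v \<in> universal G"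
    and edge: "\<And>u v. u \<in> verts G - universal G \<Longrightarrow> v \<in> verts G - universal G \<Longrightarrow>
      {\<pi> u, \<pi> v} \<in> edges G \<longleftrightarrow> {u, v} \<in> edges G"
  shows "\<pi> \<in> automorphisms G"
proof -
  have adj: "{a, b} \<in> edges G"
    if "a \<in> verts G" "b \<in> verts G" "a \<noteq> b" "a \<in> universal G \<or> b \<in> universal G" for a b
    using that by (auto simp: universal_def insert_commute)
  have "{\<pi> u, \<pi> v} \<in> edges G \<longleftrightarrow> {u, v} \<in> edges G" if V: "u \<in> verts G" "v \<in> verts G" for u v
  proof (cases "u \<noteq> v \<and> (u \<in> universal G \<or> v \<in> universal G)")
    case True
    moreover have "\<pi> u \<noteq> \<pi> v"
      using True permutes_inj[OF p] by (auto simp: inj_eq)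
    ultimately show ?thesis
      using V univ adj permutes_in_image[OF p] by metis
  next
    case False
    then show ?thesis
      using V edge singleton_not_edge[OF G] by (cases "u = v") auto
  qed
  then show ?thesis
    using p by (simp add: automorphisms_def)
qed

lemma transpose_universal_automorphism:
  assumes G: "simple_graph G" and "u \<in> universal G" "v \<in> universal G"
  shows "Transposition.transpose u v \<in> automorphisms G"
proof (rule automorphismI_universal[OF G])
  show "Transposition.transpose u v permutes verts G"
    by (intro permutes_swap_id subsetD[OF universal_subset] assms)
qed (use assms in \<open>auto simp: Transposition.transpose_def\<close>)

lemma automorphisms_remove_universal_subset:
  assumes "simple_graph G"
  shows "automorphisms (remove_universal G) \<subseteq> automorphisms G"
proof
  fix \<pi> assume \<pi>: "\<pi> \<in> automorphisms (remove_universal G)"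
  then have p: "\<pi> permutes (verts G - universal G)"
    by (simp add: automorphisms_def)
  show "\<pi> \<in> automorphisms G"
  proof (rule automorphismI_universal[OF assms])
    show "\<pi> permutes verts G"
      using p by (rule permutes_subset) auto
    show "\<pi> v \<in> universal G \<longleftrightarrow> v \<in> universal G" if "v \<in> verts G" for v
      using p that permutes_in_image[OF p, of v] by (cases "v \<in> universal G") (auto simp: permutes_def)
    show "{\<pi> u, \<pi> v} \<in> edges G \<longleftrightarrow> {u, v} \<in> edges G"
      if "u \<in> verts G - universal G" "v \<in> verts G - universal G" for u v
    proof -
      have "\<pi> u \<in> verts G - universal G" "\<pi> v \<in> verts G - universal G"
        using that by (simp_all only: permutes_in_image[OF p])
      moreover have "{\<pi> u, \<pi> v} \<in> edges (remove_universal G) \<longleftrightarrow> {u, v} \<in> edges (remove_universal G)"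
        using that \<pi> by (simp only: automorphisms_def mem_Collect_eq verts_remove_universal)
      ultimately show ?thesis
        using that by (simp only: edge_remove_universal) blast
    qed
  qed
qed

text \<open>Replacing an automorphism by the identity on the universal vertices gives an automorphism
  of the rest which extends by the identity, so orbits and stabilizer orbits of non-universal
  vertices can be computed after the removal of the universal vertices.\<close>

lemma restrict_automorphism_remove_universal:
  assumes \<sigma>: "\<sigma> \<in> automorphisms G"
  shows "(\<lambda>x. if x \<in> verts G - universal G then \<sigma> x else x) \<in> automorphisms (remove_universal G)"
    (is "?\<rho> \<in> _")
proof -
  let ?R = "verts G - universal G"
  have p: "\<sigma> permutes verts G"
    using \<sigma> by (simp add: automorphisms_def)
  have R: "\<sigma> x \<in> ?R" if "x \<in> ?R" for x
    using that automorphism_universal_iff[OF \<sigma>] automorphism_in_verts[OF \<sigma>] by blast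
  have onto: "y \<in> ?\<rho> ` ?R" if "y \<in> ?R" for y
  proof -
    have "y \<in> \<sigma> ` verts G"
      using that permutes_image[OF p] by simp
    then obtain x where x: "x \<in> verts G" "\<sigma> x = y"
      by auto
    then have "x \<in> ?R"
      using that automorphism_universal_iff[OF \<sigma> x(1)] by simp
    then show ?thesis
      using x(2) by (intro image_eqI[of _ _ x]) auto
  qed
  have "inj_on ?\<rho> ?R"
    by (rule inj_onI) (simp add: inj_eq[OF permutes_inj[OF p]])
  moreover have "?\<rho> ` ?R = ?R"
  proof
    show "?\<rho> ` ?R \<subseteq> ?R"
      using R by (intro image_subsetI) simp
    show "?R \<subseteq> ?\<rho> ` ?R"
      using onto by (rule subsetI)
  qed
  ultimately have "bij_betw ?\<rho> ?R ?R"
    by (simp only: bij_betw_def)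
  then have "?\<rho> permutes ?R"
    by (rule bij_imp_permutes) auto
  moreover have "{?\<rho> u, ?\<rho> v} \<in> edges (remove_universal G) \<longleftrightarrow> {u, v} \<in> edges (remove_universal G)"
    if "u \<in> ?R" "v \<in> ?R" for u v
    using that \<sigma> R[of u] R[of v] by (simp add: automorphisms_def)
  ultimately show ?thesis
    unfolding automorphisms_def verts_remove_universal by blast
qed


section \<open>Orbits and universal vertices\<close>

lemma orbit_remove_universal:
  assumes G: "simple_graph G" and u: "u \<in> verts G - universal G"
  shows "orbit G u = orbit (remove_universal G) u"
proof
  show "orbit (remove_universal G) u \<subseteq> orbit G u"
    using automorphisms_remove_universal_subset[OF G] by (auto simp: orbit_def)
  show "orbit G u \<subseteq> orbit (remove_universal G) u"
  proof
    fix y assume "y \<in> orbit G u"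
    then obtain \<sigma> where \<sigma>: "\<sigma> \<in> automorphisms G" "y = \<sigma> u"
      by (auto simp: orbit_def)
    let ?\<rho> = "\<lambda>x. if x \<in> verts G - universal G then \<sigma> x else x"
    have "y = ?\<rho> u"
      using \<sigma>(2) u by simp
    then show "y \<in> orbit (remove_universal G) u"
      unfolding orbit_def
      by (intro CollectI exI[of _ ?\<rho>] conjI restrict_automorphism_remove_universal \<sigma>(1))
  qed
qed

lemma stab_orbit_remove_universal:
  assumes G: "simple_graph G" and u: "u \<in> verts G - universal G" and x: "x \<in> verts G - universal G"
  shows "stab_orbit G x u = stab_orbit (remove_universal G) x u"
proof
  show "stab_orbit (remove_universal G) x u \<subseteq> stab_orbit G x u"
    using automorphisms_remove_universal_subset[OF G] by (auto simp: stab_orbit_def stabilizer_def)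
  show "stab_orbit G x u \<subseteq> stab_orbit (remove_universal G) x u"
  proof
    fix y assume "y \<in> stab_orbit G x u"
    then obtain \<sigma> where \<sigma>: "\<sigma> \<in> automorphisms G" "\<sigma> x = x" "y = \<sigma> u"
      by (auto simp: stab_orbit_def stabilizer_def)
    let ?\<rho> = "\<lambda>x. if x \<in> verts G - universal G then \<sigma> x else x"
    have "?\<rho> \<in> stabilizer (remove_universal G) x"
      using restrict_automorphism_remove_universal[OF \<sigma>(1)] \<sigma>(2) by (simp add: stabilizer_def)
    moreover have "y = ?\<rho> u"
      using \<sigma>(3) u by simp
    ultimately show "y \<in> stab_orbit (remove_universal G) x u"
      unfolding stab_orbit_def by (intro CollectI exI[of _ ?\<rho>] conjI)
  qed
qed

text \<open>What an automorphism does outside the universal vertices is also done by one that fixes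
  all universal vertices, in particular \<open>x\<close>.\<close>

lemma stab_orbit_at_universal:
  assumes G: "simple_graph G" and u: "u \<in> verts G - universal G" and x: "x \<in> universal G"
  shows "stab_orbit G x u = orbit G u"
proof
  show "stab_orbit G x u \<subseteq> orbit G u"
    by (auto simp: stab_orbit_def stabilizer_def orbit_def)
  have "\<pi> x = x" if "\<pi> \<in> automorphisms (remove_universal G)" for \<pi>
    using that x by (auto simp: automorphisms_def permutes_def)
  then have "orbit (remove_universal G) u \<subseteq> stab_orbit G x u"
    using automorphisms_remove_universal_subset[OF G]
    by (auto simp: stab_orbit_def stabilizer_def orbit_def)
  then show "orbit G u \<subseteq> stab_orbit G x u"
    using orbit_remove_universal[OF G u] by simp
qed

lemma orbit_universal:
  assumes G: "simple_graph G" and u: "u \<in> universal G"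
  shows "orbit G u = universal G"
proof
  show "orbit G u \<subseteq> universal G"
    using u universal_subset automorphism_universal_iff unfolding orbit_def by fastforce
  have "v \<in> orbit G u" if "v \<in> universal G" for v
    using transpose_universal_automorphism[OF G u that]
    unfolding orbit_def by (intro CollectI exI[of _ "Transposition.transpose u v"]) simp
  then show "universal G \<subseteq> orbit G u"
    by blast
qed

lemma automorphisms_comp:
  assumes "\<sigma> \<in> automorphisms G" "\<tau> \<in> automorphisms G"
  shows "\<sigma> \<circ> \<tau> \<in> automorphisms G"
proof -
  have "\<sigma> \<circ> \<tau> permutes verts G"
    by (rule permutes_compose[OF automorphismsD(1)[OF assms(2)] automorphismsD(1)[OF assms(1)]])
  moreover have "{(\<sigma> \<circ> \<tau>) u, (\<sigma> \<circ> \<tau>) v} \<in> edges G \<longleftrightarrow> {u, v} \<in> edges G"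
    if "u \<in> verts G" "v \<in> verts G" for u v
    unfolding o_apply
    by (simp only: automorphismsD(2)[OF assms(1)] automorphismsD(2)[OF assms(2)]
        automorphism_in_verts[OF assms(2)] that)
  ultimately show ?thesis
    unfolding automorphisms_def by (intro CollectI conjI ballI)
qed

lemma self_in_stab_orbit: "u \<in> stab_orbit G x u"
  unfolding stab_orbit_def stabilizer_def using id_in_automorphisms[of G]
  by (intro CollectI exI[of _ id]) simp

lemma stab_orbit_self: "stab_orbit G x x = {x}"
  using self_in_stab_orbit[of x G x] by (auto simp: stab_orbit_def stabilizer_def)

lemma stab_orbit_transpose_subset:
  assumes "Transposition.transpose u v \<in> automorphisms G" "x \<noteq> u" "x \<noteq> v"
  shows "stab_orbit G x v \<subseteq> stab_orbit G x u"
proof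
  fix y assume "y \<in> stab_orbit G x v"
  then obtain \<sigma> where \<sigma>: "\<sigma> \<in> automorphisms G" "\<sigma> x = x" "y = \<sigma> v"
    by (auto simp: stab_orbit_def stabilizer_def)
  have "\<sigma> \<circ> Transposition.transpose u v \<in> automorphisms G"
    using \<sigma>(1) assms(1) by (rule automorphisms_comp)
  then show "y \<in> stab_orbit G x u"
    using \<sigma> assms(2,3) unfolding stab_orbit_def stabilizer_def
    by (intro CollectI exI[of _ "\<sigma> \<circ> Transposition.transpose u v"]) simp
qed

text \<open>The vertex \<open>u\<close> separates itself from \<open>v\<close>, since its stabilizer leaves it alone in its orbit;
  no third vertex does, since the transposition of \<open>u\<close> and \<open>v\<close> fixes it and merges the two
  orbits.\<close>

lemma fixing_set_universal:
  assumes G: "simple_graph G" and u: "u \<in> universal G" and v: "v \<in> universal G" and "u \<noteq> v"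
  shows "fixing_set G u v = {u, v}"
proof -
  have "stab_orbit G x u = stab_orbit G x v" if "x \<noteq> u" "x \<noteq> v" for x
    using stab_orbit_transpose_subset[OF transpose_universal_automorphism[OF G u v]]
      stab_orbit_transpose_subset[OF transpose_universal_automorphism[OF G v u]] that
    by blast
  moreover have "stab_orbit G u u \<noteq> stab_orbit G u v" "stab_orbit G v u \<noteq> stab_orbit G v v"
    using \<open>u \<noteq> v\<close> stab_orbit_self[of G] self_in_stab_orbit[of _ G] by (metis singletonD)+
  ultimately show ?thesis
    using u v universal_subset[of G] by (auto simp: fixing_set_def)
qed

lemma fixing_set_remove_universal:
  assumes G: "simple_graph G" and uv: "(u, v) \<in> Va (remove_universal G)"
  shows "fixing_set G u v = fixing_set (remove_universal G) u v"
proof -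
  have V: "u \<in> verts G - universal G" "v \<in> verts G - universal G"
    and "orbit G u = orbit G v"
    using uv by (auto simp: Va_def orbit_remove_universal[OF G])
  then have "stab_orbit G x u \<noteq> stab_orbit G x v \<longleftrightarrow> x \<notin> universal G \<and>
      stab_orbit (remove_universal G) x u \<noteq> stab_orbit (remove_universal G) x v"
    if "x \<in> verts G" for x
    using that by (cases "x \<in> universal G")
      (simp_all add: stab_orbit_at_universal[OF G] stab_orbit_remove_universal[OF G])
  then show ?thesis
    unfolding fixing_set_def verts_remove_universal by blast
qed

lemma Va_split_universal:
  assumes G: "simple_graph G"
  shows "Va G = {(u, v). u \<in> universal G \<and> v \<in> universal G \<and> u \<noteq> v} \<union> Va (remove_universal G)"
proof -
  have both: "u \<in> universal G \<longleftrightarrow> v \<in> universal G" if "orbit G u = orbit G v" for u v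
    using that self_in_orbit[of u G] self_in_orbit[of v G] orbit_universal[OF G, of u]
      orbit_universal[OF G, of v] by blast
  have "(u, v) \<in> Va G \<longleftrightarrow> (u \<in> universal G \<and> v \<in> universal G \<and> u \<noteq> v) \<or>
      (u, v) \<in> Va (remove_universal G)" for u v
  proof (cases "u \<in> universal G \<or> v \<in> universal G")
    case True
    then show ?thesis
      using both[of u v] universal_subset[of G] orbit_universal[OF G, of u]
        orbit_universal[OF G, of v] unfolding Va_def by auto
  next
    case False
    then show ?thesis
      unfolding Va_def by (auto simp: orbit_remove_universal[OF G])
  qed
  then show ?thesis
    by (intro subset_antisym subrelI) simp_all
qed


section \<open>Splitting off the universal vertices\<close>

lemma fixing_function_iff_split:
  assumes G: "simple_graph G"
  shows "fixing_function G g \<longleftrightarrow>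
    fixing_function (remove_universal G) g \<and> (\<forall>u \<in> universal G. g u \<in> {0..1}) \<and>
    (\<forall>u \<in> universal G. \<forall>v \<in> universal G. u \<noteq> v \<longrightarrow> g u + g v \<ge> 1)"
proof -
  have "(\<forall>(u, v) \<in> Va G. (\<Sum>x \<in> fixing_set G u v. g x) \<ge> 1) \<longleftrightarrow>
    (\<forall>(u, v) \<in> Va (remove_universal G). (\<Sum>x \<in> fixing_set G u v. g x) \<ge> 1) \<and>
    (\<forall>u \<in> universal G. \<forall>v \<in> universal G. u \<noteq> v \<longrightarrow> (\<Sum>x \<in> fixing_set G u v. g x) \<ge> 1)"
    unfolding Va_split_universal[OF G] by blast
  also have "(\<forall>(u, v) \<in> Va (remove_universal G). (\<Sum>x \<in> fixing_set G u v. g x) \<ge> 1) \<longleftrightarrow>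
    (\<forall>(u, v) \<in> Va (remove_universal G). (\<Sum>x \<in> fixing_set (remove_universal G) u v. g x) \<ge> 1)"
    using fixing_set_remove_universal[OF G] by (intro ball_cong refl) (simp add: split_beta)
  also have "(\<forall>u \<in> universal G. \<forall>v \<in> universal G. u \<noteq> v \<longrightarrow>
      (\<Sum>x \<in> fixing_set G u v. g x) \<ge> 1) \<longleftrightarrow>
    (\<forall>u \<in> universal G. \<forall>v \<in> universal G. u \<noteq> v \<longrightarrow> g u + g v \<ge> 1)"
    using fixing_set_universal[OF G] by (intro ball_cong imp_cong refl) simp
  finally have pairs: "(\<forall>(u, v) \<in> Va G. (\<Sum>x \<in> fixing_set G u v. g x) \<ge> 1) \<longleftrightarrow>
    (\<forall>(u, v) \<in> Va (remove_universal G). (\<Sum>x \<in> fixing_set (remove_universal G) u v. g x) \<ge> 1) \<and>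
    (\<forall>u \<in> universal G. \<forall>v \<in> universal G. u \<noteq> v \<longrightarrow> g u + g v \<ge> 1)" .
  have range: "(\<forall>x \<in> verts G. g x \<in> {0..1}) \<longleftrightarrow>
    (\<forall>x \<in> verts G - universal G. g x \<in> {0..1}) \<and> (\<forall>x \<in> universal G. g x \<in> {0..1})"
    using universal_subset[of G] by blast
  show ?thesis
    unfolding fixing_function_def verts_remove_universal pairs range by (simp only: conj_ac)
qed

lemma weight_split:
  assumes "simple_graph G"
  shows "weight G g = weight (remove_universal G) g + (\<Sum>u \<in> universal G. g u)"
  using assms universal_subset[of G]
  by (simp add: weight_def simple_graph_def sum.subset_diff)

text \<open>At most one value is below \<open>1/2\<close>. If there is one, at \<open>a\<close> say, then the value at any other
  point is at least \<open>1 - g a\<close>, and pairing \<open>a\<close> with a single other point makes good the deficit.\<close>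

lemma half_card_le_sum_if_pairs_ge_1:
  fixes g :: "'a \<Rightarrow> real"
  assumes fin: "finite U" and card: "card U \<ge> 2"
    and pair: "\<And>u v. u \<in> U \<Longrightarrow> v \<in> U \<Longrightarrow> u \<noteq> v \<Longrightarrow> g u + g v \<ge> 1"
  shows "card U / 2 \<le> (\<Sum>u \<in> U. g u)"
proof (cases "\<forall>u \<in> U. g u \<ge> 1 / 2")
  case True
  then show ?thesis
    using sum_bounded_below[of U "1 / 2" g] by simp
next
  case False
  then obtain a where a: "a \<in> U" "g a < 1 / 2"
    by auto
  have "\<not> U \<subseteq> {a}"
    using card card_mono[of "{a}" U] by auto
  then obtain b where b: "b \<in> U" "b \<noteq> a"
    by auto
  have "card (U - {a, b}) * (1 / 2) \<le> (\<Sum>u \<in> U - {a, b}. g u)"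
    using a pair by (intro sum_bounded_below) force
  moreover have "card (U - {a, b}) = card U - 2"
    using a b fin by (simp add: card_Diff_subset)
  moreover have "(\<Sum>u \<in> U. g u) = (\<Sum>u \<in> U - {a, b}. g u) + (g a + g b)"
    using a b fin by (subst sum.subset_diff[of "{a, b}"]) auto
  moreover have "g a + g b \<ge> 1"
    using a b pair by auto
  ultimately show ?thesis
    using card by (simp add: of_nat_diff field_simps)
qed

theorem fix_f_remove_universal:
  assumes G: "simple_graph G"
  shows "fix_f G = fix_f (remove_universal G) +
    (if card (universal G) \<ge> 2 then card (universal G) / 2 else 0)"
proof (rule antisym)
  let ?c = "if card (universal G) \<ge> 2 then 1 / 2 else (0::real)"
  have fin: "finite (universal G)"
    using G by (rule finite_universal)
  have few: "\<not> (u \<in> universal G \<and> v \<in> universal G \<and> u \<noteq> v)" if "\<not> card (universal G) \<ge> 2" for u v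
  proof
    assume uv: "u \<in> universal G \<and> v \<in> universal G \<and> u \<noteq> v"
    then have "card {u, v} \<le> card (universal G)"
      by (intro card_mono[OF fin]) simp
    then show False
      using uv that by simp
  qed
  obtain r where r: "fixing_function (remove_universal G) r"
    "weight (remove_universal G) r = fix_f (remove_universal G)"
    using fix_f_attained[OF simple_graph_remove_universal[OF G]] by blast
  \<comment> \<open>An optimum of the remaining graph, extended by the constant optimum on the universal vertices:
    \<open>1/2\<close> each, or \<open>0\<close> if there is no pair of them to separate.\<close>
  define g where "g = (\<lambda>x. if x \<in> universal G then ?c else r x)"
  have "(\<Sum>x \<in> fixing_set (remove_universal G) u v. g x) =
        (\<Sum>x \<in> fixing_set (remove_universal G) u v. r x)" for u v
    by (rule sum.cong) (auto simp: fixing_set_def g_def)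
  then have "fixing_function (remove_universal G) g"
    using r(1) by (auto simp: fixing_function_def g_def)
  then have "fixing_function G g"
    unfolding fixing_function_iff_split[OF G] using few by (auto simp: g_def)
  moreover have "weight (remove_universal G) g = weight (remove_universal G) r"
    unfolding weight_def by (rule sum.cong) (auto simp: g_def)
  ultimately show "fix_f G \<le> fix_f (remove_universal G) +
      (if card (universal G) \<ge> 2 then card (universal G) / 2 else 0)"
    using fix_f_le[OF G, of g] r(2) by (auto simp: weight_split[OF G] g_def)
next
  obtain g where g: "fixing_function G g" "weight G g = fix_f G"
    using fix_f_attained[OF G] by blast
  have fin: "finite (universal G)"
    using G by (rule finite_universal)
  have split: "fixing_function (remove_universal G) g" "\<forall>u \<in> universal G. g u \<ge> 0"
    "\<And>u v. u \<in> universal G \<Longrightarrow> v \<in> universal G \<Longrightarrow> u \<noteq> v \<Longrightarrow> g u + g v \<ge> 1"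
    using g(1) by (auto simp: fixing_function_iff_split[OF G])
  have "(if card (universal G) \<ge> 2 then card (universal G) / 2 else 0) \<le> (\<Sum>u \<in> universal G. g u)"
    using half_card_le_sum_if_pairs_ge_1[OF fin _ split(3)] split(2) by (auto intro: sum_nonneg)
  moreover have "fix_f (remove_universal G) \<le> weight (remove_universal G) g"
    by (rule fix_f_le[OF simple_graph_remove_universal[OF G] split(1)])
  ultimately show "fix_f (remove_universal G) +
      (if card (universal G) \<ge> 2 then card (universal G) / 2 else 0) \<le> fix_f G"
    using g(2) weight_split[OF G, of g] by simp
qed


section \<open>The corona product with the one-vertex graph\<close>

lemma simple_graph_K1_corona:
  assumes "simple_graph H"
  shows "simple_graph (K1_corona H)"
  using assms unfolding simple_graph_def K1_corona_def by fastforce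

lemma edge_K1_corona_Some: "{Some u, Some v} \<in> edges (K1_corona H) \<longleftrightarrow> {u, v} \<in> edges H"
proof -
  have "{Some u, Some v} = Some ` e \<longleftrightarrow> {u, v} = e" for e
    using inj_image_eq_iff[of Some "{u, v}" e] by simp
  moreover have "{Some u, Some v} \<noteq> {None, Some w}" for w
    by auto
  ultimately show ?thesis
    by (simp add: K1_corona_def image_iff)
qed

lemma edge_K1_corona_None: "u \<in> verts H \<Longrightarrow> {None, Some u} \<in> edges (K1_corona H)"
  by (auto simp: K1_corona_def)

lemma universal_K1_corona: "universal (K1_corona H) = insert None (Some ` universal H)"
proof -
  have V: "verts (K1_corona H) = insert None (Some ` verts H)"
    by (simp add: K1_corona_def)
  show ?thesis
    using edge_K1_corona_None[of _ H]
    by (auto simp: universal_def V edge_K1_corona_Some insert_commute)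
qed

lemma remove_universal_K1_corona_iso:
  "graph_iso Some (remove_universal H) (remove_universal (K1_corona H))"
proof -
  have V: "verts (K1_corona H) - universal (K1_corona H) = Some ` (verts H - universal H)"
    unfolding universal_K1_corona by (auto simp: K1_corona_def)
  then show ?thesis
    by (auto simp: graph_iso_def bij_betw_def edge_K1_corona_Some)
qed

lemma vertex_degree_eq_iff_universal:
  assumes H: "simple_graph H" and v: "v \<in> verts H"
  shows "vertex_degree H v = card (verts H) - 1 \<longleftrightarrow> v \<in> universal H"
proof -
  let ?N = "{w \<in> verts H. {w, v} \<in> edges H}"
  have fin: "finite (verts H)"
    using H by (simp add: simple_graph_def)
  have sub: "?N \<subseteq> verts H - {v}"
    using singleton_not_edge[OF H] by auto
  have "vertex_degree H v = card (verts H) - 1 \<longleftrightarrow> card ?N = card (verts H - {v})"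
    using v fin by (simp add: vertex_degree_def insert_commute)
  also have "\<dots> \<longleftrightarrow> ?N = verts H - {v}"
    using card_subset_eq[OF finite_Diff[OF fin] sub] by (rule iffI) (assumption, erule arg_cong[where f = card])
  also have "\<dots> \<longleftrightarrow> v \<in> universal H"
    using v sub by (simp add: universal_def set_eq_iff subset_iff) blast
  finally show ?thesis .
qed

theorem theorem5p5:
  fixes H :: "'a graph" and k :: nat
  assumes "simple_graph H"
    and "card (verts H) \<ge> 2"
    and "max_degree H = card (verts H) - 1"
    and "card {v \<in> verts H. vertex_degree H v = card (verts H) - 1} = k"
  shows "(k = 1 \<longrightarrow> fix_f (K1_corona H) = fix_f H + 1) \<and>
         (k \<ge> 2 \<longrightarrow> fix_f (K1_corona H) = fix_f H + 1 / 2)"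
proof -
  have "{v \<in> verts H. vertex_degree H v = card (verts H) - 1} = universal H"
    using vertex_degree_eq_iff_universal[OF assms(1)] universal_subset[of H] by blast
  then have k: "card (universal H) = k"
    using assms(4) by simp
  have k': "card (universal (K1_corona H)) = k + 1"
    using k finite_universal[OF assms(1)] by (simp add: universal_K1_corona card_image)
  have "fix_f (remove_universal H) = fix_f (remove_universal (K1_corona H))"
    using assms(1)
    by (intro fix_f_iso[OF remove_universal_K1_corona_iso] simple_graph_remove_universal
        simple_graph_K1_corona)
  then show ?thesis
    using fix_f_remove_universal[OF assms(1)]
      fix_f_remove_universal[OF simple_graph_K1_corona[OF assms(1)]] k k'
    by (simp add: add_divide_distrib)
qed

end
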